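(* Let $u_0\in L^\infty(\mathbb R)\cap C^1(\mathbb R\setminus\{0\})$ satisfy $\lim_{|x|\rightarrow+0}|x\,u_0'(x)|=0$. Let $u(x,t)$ be the solution to the Cauchy problem $u_t=u_{xx}$ on $\mathbb R\times(0,+\infty)$, $u(x,0)=u_0(x)$ for $x\in\mathbb R$. Then, for all $L>0$, $$\lim_{t\rightarrow+0}\ \sup_{x\in[-L,+L]}\left|u(\sqrt t\,x,t)-\left(F(-x)\,u_0(-\sqrt t)+F(+x)\,u_0(+\sqrt t)\right)\right|=0,$$ where $F(z):=\frac{1}{2\sqrt\pi}\int_{-\infty}^z e^{-\frac{y^2}{4}}\,dy$.
   Context: The solution to the Cauchy problem of the heat equation with initial value $u_0$ is the one given by the heat kernel: $u(x,t)=\frac{1}{2\sqrt{\pi t}}\int_{-\infty}^{+\infty}e^{-\frac{(x-y)^2}{4t}}u_0(y)\,dy$ for $(x,t)\in\mathbb R\times(0,+\infty)$. The condition $u_0\in L^\infty(\mathbb R)\cap C^1(\mathbb R\setminus\{0\})$ means that $u_0$ is bounded and continuously differentiable on $\mathbb R\setminus\{0\}$; no regularity at $0$ is assumed. The notation $s\rightarrow+0$ means that $s$ tends to $0$ from above, $s>0$. *)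

theory Defs
  imports "HOL-Analysis.Analysis"
begin

(* Only meant for t > 0: at t = 0 division by zero makes the value 0, not u0 x. *)
definition heat_solution :: "(real \<Rightarrow> real) \<Rightarrow> real \<Rightarrow> real \<Rightarrow> real" where
  "heat_solution u0 x t =
     1 / (2 * sqrt (pi * t)) * (LBINT y. exp (- ((x - y)\<^sup>2 / (4 * t))) * u0 y)"

definition F :: "real \<Rightarrow> real" where
  "F z = 1 / (2 * sqrt pi) * (LBINT y:{..z}. exp (- (y\<^sup>2 / 4)))"

end

theory Submission
  imports Defs "HOL-Probability.Distributions"
begin

(* Substituting y = sqrt t * z turns the heat solution at (sqrt t * x, t) into the average of
   u0 (sqrt t * z) against the Gaussian density centred at x, and the two terms with F into the
   average of u0 (- sqrt t) over z < 0 and of u0 (sqrt t) over z > 0.  For |x| \<le> L the densities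
   are dominated by a multiple of one fixed Gaussian, so it suffices that
   u0 (sqrt t * z) - u0 (sgn z * sqrt t) tends to 0 for each z \<noteq> 0 (dominated convergence).  This
   follows from the mean value theorem, since the derivative of u0 at \<xi> is o(1 / |\<xi>|) and
   \<xi> is comparable to sqrt t. *)

text \<open>The heat kernel at time 1 is the normal density of variance 2, so the library facts on
  normal densities apply to it.\<close>

lemma normal_density_sqrt2:
  "normal_density x (sqrt 2) z = 1 / (2 * sqrt pi) * exp (- ((x - z)\<^sup>2 / 4))"
proof -
  have "sqrt (2 * pi * 2) = 2 * sqrt pi"
    using real_sqrt_mult[of 4 pi] by simp
  then show ?thesis
    by (simp add: normal_density_def power2_commute)
qed

text \<open>The Jacobian \<open>sqrt t\<close> of the substitution cancels the \<open>sqrt t\<close>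
  in the prefactor of the heat kernel, and the exponent no longer contains \<open>t\<close>.\<close>

lemma heat_solution_rescaled:
  assumes "t > 0"
  shows "heat_solution u0 (sqrt t * x) t
       = (LBINT z. normal_density x (sqrt 2) z * u0 (sqrt t * z))"
proof -
  have "(LBINT y. exp (- ((sqrt t * x - y)\<^sup>2 / (4 * t))) * u0 y)
      = sqrt t * (LBINT z. exp (- ((sqrt t * x - sqrt t * z)\<^sup>2 / (4 * t))) * u0 (sqrt t * z))"
    using assms
    by (subst lborel_integral_real_affine[where c = "sqrt t" and t = 0]) auto
  moreover have "(sqrt t * x - sqrt t * z)\<^sup>2 / (4 * t) = (x - z)\<^sup>2 / 4" for z
    using assms
    by (simp flip: right_diff_distrib add: power_mult_distrib)
  ultimately show ?thesis
    using assms
    by (simp add: heat_solution_def normal_density_sqrt2 real_sqrt_mult flip: mult.assoc)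
qed

text \<open>The reflection y = x - z carries y \<le> x to z \<ge> 0.\<close>

lemma F_eq_integral_atLeast:
  "F x = (LBINT z. normal_density x (sqrt 2) z * indicator {0..} z)"
proof -
  have "(LBINT y:{..x}. exp (- (y\<^sup>2 / 4)))
      = (LBINT z. exp (- ((x - z)\<^sup>2 / 4)) * indicator {0..} z)"
    unfolding set_lebesgue_integral_def
    by (subst lborel_integral_real_affine[where c = "-1" and t = x])
      (auto intro!: Bochner_Integration.integral_cong simp: indicator_def)
  then show ?thesis
    by (simp add: F_def normal_density_sqrt2 mult.assoc)
qed

text \<open>The translation y = z - x carries y \<le> -x to z \<le> 0.\<close>

lemma F_minus_eq_integral_atMost:
  "F (- x) = (LBINT z. normal_density x (sqrt 2) z * indicator {..0} z)"
proof -
  have "(LBINT y:{..- x}. exp (- (y\<^sup>2 / 4)))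
      = (LBINT z. exp (- ((x - z)\<^sup>2 / 4)) * indicator {..0} z)"
    unfolding set_lebesgue_integral_def
    by (subst lborel_integral_real_affine[where c = 1 and t = "- x"])
      (auto intro!: Bochner_Integration.integral_cong simp: indicator_def power2_commute)
  then show ?thesis
    by (simp add: F_def normal_density_sqrt2 mult.assoc)
qed

lemma integrable_normal_density_mult_bounded:
  fixes f :: "real \<Rightarrow> real"
  assumes "\<sigma> > 0" "f \<in> borel_measurable borel" "\<And>z. \<bar>f z\<bar> \<le> B"
  shows "integrable lborel (\<lambda>z. normal_density \<mu> \<sigma> z * f z)"
proof (rule Bochner_Integration.integrable_bound)
  show "integrable lborel (\<lambda>z. B * normal_density \<mu> \<sigma> z)"
    using assms(1) by simp
  show "(\<lambda>z. normal_density \<mu> \<sigma> z * f z) \<in> borel_measurable lborel"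
    using assms(2) by measurable
  have "\<bar>f z\<bar> \<le> \<bar>B\<bar>" for z
    using assms(3)[of z] by linarith
  then show "AE z in lborel. norm (normal_density \<mu> \<sigma> z * f z) \<le> norm (B * normal_density \<mu> \<sigma> z)"
    by (auto simp: abs_mult mult.commute intro!: mult_right_mono)
qed

text \<open>Doubling the variance from 2 to 4 absorbs the cross term of the shifted square, at the
  cost of a factor depending only on \<open>L\<close>.\<close>

lemma normal_density_shift_le:
  assumes "\<bar>x\<bar> \<le> L"
  shows "normal_density x (sqrt 2) z \<le> sqrt 2 * exp (L\<^sup>2 / 4) * normal_density 0 2 z"
proof -
  \<comment> \<open>The right side exceeds the left by (2 x - z)^2 / 2.\<close>
  have "z\<^sup>2 / 2 - x\<^sup>2 \<le> (x - z)\<^sup>2"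
    using zero_le_power2[of "2 * x - z"] by (simp add: power2_eq_square algebra_simps)
  moreover have "x\<^sup>2 \<le> L\<^sup>2"
    using power_mono[OF assms, of 2] by simp
  ultimately have "- ((x - z)\<^sup>2 / 4) \<le> L\<^sup>2 / 4 - z\<^sup>2 / 8"
    by simp
  then have "exp (- ((x - z)\<^sup>2 / 4)) \<le> exp (L\<^sup>2 / 4) * exp (- (z\<^sup>2 / 8))"
    by (simp flip: exp_add)
  moreover have "normal_density 0 2 z = 1 / (sqrt 2 * (2 * sqrt pi)) * exp (- (z\<^sup>2 / 8))"
    using real_sqrt_mult[of 4 "2 * pi"]
    by (simp add: normal_density_def real_sqrt_mult mult.commute)
  ultimately show ?thesis
    by (simp add: normal_density_sqrt2 divide_right_mono)
qed

text \<open>The mean value theorem gives a point \<xi> between t a and t b where the difference is t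
  (b - a) g'(\<xi>). Since t a < \<xi>, its absolute value is at most (b - a) / a times |\<xi>
  g'(\<xi>)|.\<close>

lemma tendsto_diff_rescaled_less:
  fixes g g' :: "real \<Rightarrow> real"
  assumes g': "\<And>x. x > 0 \<Longrightarrow> (g has_real_derivative g' x) (at x)"
    and lim: "((\<lambda>x. x * g' x) \<longlongrightarrow> 0) (at_right 0)"
    and "0 < a" "a < b"
  shows "((\<lambda>t. g (t * b) - g (t * a)) \<longlongrightarrow> 0) (at_right 0)"
proof (rule tendstoI)
  fix e :: real
  assume "e > 0"
  \<comment> \<open>Chosen so that (b - a) / a * r equals \<open>e\<close>.\<close>
  define r where "r = e * a / (b - a)"
  have "r > 0"
    using \<open>e > 0\<close> assms by (simp add: r_def)
  then obtain d where "d > 0" and d: "\<And>x. 0 < x \<Longrightarrow> x < d \<Longrightarrow> \<bar>x * g' x\<bar> < r"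
    using tendstoD[OF lim] unfolding eventually_at_right_field by auto
  \<comment> \<open>The bound on \<open>t\<close> gives t b < d, so the intermediate point is also
    below \<open>d\<close>.\<close>
  have "dist (g (t * b) - g (t * a)) 0 < e" if "0 < t" "t < d / b" for t
  proof -
    have "t * a < t * b"
      using that assms by simp
    moreover have "(g has_real_derivative g' x) (at x)" if "t * a \<le> x" for x
      using g' that \<open>0 < t\<close> \<open>0 < a\<close> by (meson less_le_trans mult_pos_pos)
    ultimately obtain \<xi> where \<xi>: "t * a < \<xi>" "\<xi> < t * b"
      and eq: "g (t * b) - g (t * a) = (t * b - t * a) * g' \<xi>"
      using MVT2[of "t * a" "t * b" g g'] by blast
    have "0 < t * a"
      using that assms by simp
    with \<xi> have "0 < \<xi>" by linarith
    have "\<xi> < d"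
      using \<xi> that assms by (simp add: field_simps)
    have "\<bar>t * b - t * a\<bar> * \<bar>g' \<xi>\<bar> * a = (b - a) * ((t * a) * \<bar>g' \<xi>\<bar>)"
      using \<open>t * a < t * b\<close> by (simp add: algebra_simps)
    also have "\<dots> \<le> (b - a) * \<bar>\<xi> * g' \<xi>\<bar>"
      using mult_right_mono[of "t * a" \<xi> "\<bar>g' \<xi>\<bar>"] \<xi> \<open>0 < \<xi>\<close> assms by (simp add: abs_mult)
    also have "\<dots> < (b - a) * r"
      using d[OF \<open>0 < \<xi>\<close> \<open>\<xi> < d\<close>] assms by simp
    also have "\<dots> = e * a"
      using assms by (simp add: r_def)
    finally show ?thesis
      using \<open>0 < a\<close> by (simp add: eq abs_mult)
  qed
  moreover have "d / b > 0"
    using \<open>d > 0\<close> assms by simp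
  ultimately show "\<forall>\<^sub>F t in at_right 0. dist (g (t * b) - g (t * a)) 0 < e"
    unfolding eventually_at_right_field by blast
qed

text \<open>Exchanging \<open>a\<close> and \<open>b\<close> only changes the sign of the
  difference. Both orders occur, because |z| may lie on either side of 1.\<close>

lemma tendsto_diff_rescaled:
  fixes g g' :: "real \<Rightarrow> real"
  assumes "\<And>x. x > 0 \<Longrightarrow> (g has_real_derivative g' x) (at x)"
    and "((\<lambda>x. x * g' x) \<longlongrightarrow> 0) (at_right 0)"
    and "0 < a" "0 < b"
  shows "((\<lambda>t. g (t * b) - g (t * a)) \<longlongrightarrow> 0) (at_right 0)"
proof (rule linorder_cases[of a b])
  assume "b < a"
  from tendsto_minus[OF tendsto_diff_rescaled_less[OF assms(1,2,4) this]] show ?thesis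
    by simp
qed (use tendsto_diff_rescaled_less assms in auto)

text \<open>For positive z, compare the points t and t z; the negative half-line reduces to this
  case by the reflection x to -x.\<close>

lemma tendsto_diff_rescaled_sgn:
  fixes g g' :: "real \<Rightarrow> real"
  assumes g': "\<And>x. x \<noteq> 0 \<Longrightarrow> (g has_real_derivative g' x) (at x)"
    and lim: "((\<lambda>x. x * g' x) \<longlongrightarrow> 0) (at 0)"
    and "z \<noteq> 0"
  shows "((\<lambda>t. g (t * z) - g (t * sgn z)) \<longlongrightarrow> 0) (at_right 0)"
proof (cases "z > 0")
  case True
  then show ?thesis
    using tendsto_diff_rescaled[of g g' 1 z] g' lim filterlim_at_split by auto
next
  case False
  with \<open>z \<noteq> 0\<close> have "z < 0" by simp
  have "((\<lambda>x. g (- x)) has_real_derivative - g' (- x)) (at x)" if "x > 0" for x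
    using g'[of "- x"] that by (simp add: DERIV_mirror)
  \<comment> \<open>This function is y g'(y) at y = -x, so the left-hand limit at 0 becomes a
    right-hand one.\<close>
  moreover have "((\<lambda>x. x * - g' (- x)) \<longlongrightarrow> 0) (at_right 0)"
    using lim unfolding filterlim_at_split by (simp add: filterlim_at_left_to_right)
  ultimately show ?thesis
    using tendsto_diff_rescaled[of "\<lambda>x. g (- x)" "\<lambda>x. - g' (- x)" 1 "- z"] \<open>z < 0\<close> by simp
qed

theorem proposition5:
  fixes u0 :: "real \<Rightarrow> real" and L :: real
  assumes "bounded (range u0)"
    and "u0 C1_differentiable_on (- {0})"
    and "((\<lambda>x. \<bar>x * deriv u0 x\<bar>) \<longlongrightarrow> 0) (at 0)"
    and "L > 0"
  shows "((\<lambda>t. SUP x\<in>{-L..L}.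
            \<bar>heat_solution u0 (sqrt t * x) t - (F (- x) * u0 (- sqrt t) + F x * u0 (sqrt t))\<bar>)
          \<longlongrightarrow> 0) (at_right 0)"
proof -
  obtain B where B: "\<And>x. \<bar>u0 x\<bar> \<le> B"
    using assms(1) by (auto simp: bounded_iff)
  then have "B \<ge> 0"
    by (meson abs_ge_zero order_trans)
  \<comment> \<open>The C1 assumption yields some derivative \<open>D\<close>; uniqueness then
    identifies it with \<open>deriv u0\<close>.\<close>
  obtain D where D: "\<And>x. x \<noteq> 0 \<Longrightarrow> (u0 has_real_derivative D x) (at x)"
    using assms(2)
    by (auto simp: C1_differentiable_on_def has_real_derivative_iff_has_vector_derivative)
  have u0': "(u0 has_real_derivative deriv u0 x) (at x)" if "x \<noteq> 0" for x
    using D[OF that] DERIV_imp_deriv by fastforce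
  have lim: "((\<lambda>x. x * deriv u0 x) \<longlongrightarrow> 0) (at 0)"
    using assms(3) tendsto_rabs_zero_iff by blast
  \<comment> \<open>\<open>u0\<close> is continuous off 0, and a countable exceptional set keeps it
    Borel measurable.\<close>
  have meas [measurable]: "u0 \<in> borel_measurable borel"
    by (rule borel_measurable_continuous_countable_exceptions[of "{0}"])
      (auto intro!: continuous_at_imp_continuous_on DERIV_isCont[OF u0'])
  \<comment> \<open>Both indicators contain 0, so the two values add up there. Hence the bounds 2 B
    and 3 B below; the single point is a null set.\<close>
  define step where "step t z = indicator {..0} z * u0 (- sqrt t) + indicator {0..} z * u0 (sqrt t)"
    for t z :: real
  have step_meas [measurable]: "step t \<in> borel_measurable borel" for t
    unfolding step_def by measurable
  have step_bound: "\<bar>step t z\<bar> \<le> 2 * B" for t z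
    using B[of "sqrt t"] B[of "- sqrt t"] \<open>B \<ge> 0\<close>
    by (auto simp: step_def indicator_def abs_le_iff)
  have diff_bound: "\<bar>u0 (sqrt t * z) - step t z\<bar> \<le> 3 * B" for t z
    using B[of "sqrt t * z"] step_bound[of t z] by linarith
  define C where "C = sqrt 2 * exp (L\<^sup>2 / 4)"
  \<comment> \<open>This majorant does not depend on \<open>x\<close>, so it bounds the supremum
    over the whole interval.\<close>
  define R where "R t = C * (LBINT z. normal_density 0 2 z * \<bar>u0 (sqrt t * z) - step t z\<bar>)" for t
  have bound: "\<bar>heat_solution u0 (sqrt t * x) t - (F (- x) * u0 (- sqrt t) + F x * u0 (sqrt t))\<bar> \<le> R t"
    if "t > 0" and x: "x \<in> {-L..L}" for t x
  proof -
    note int = integrable_normal_density_mult_bounded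
    have "F (- x) * u0 (- sqrt t) + F x * u0 (sqrt t)
        = (LBINT z. normal_density x (sqrt 2) z * indicator {..0} z * u0 (- sqrt t)
             + normal_density x (sqrt 2) z * indicator {0..} z * u0 (sqrt t))"
      unfolding F_minus_eq_integral_atMost F_eq_integral_atLeast[of x]
      by (subst Bochner_Integration.integral_add)
        (auto intro!: integrable_mult_left int[where B = 1] simp: indicator_def)
    also have "\<dots> = (LBINT z. normal_density x (sqrt 2) z * step t z)"
      by (simp add: step_def algebra_simps)
    finally have "heat_solution u0 (sqrt t * x) t - (F (- x) * u0 (- sqrt t) + F x * u0 (sqrt t))
        = (LBINT z. normal_density x (sqrt 2) z * (u0 (sqrt t * z) - step t z))"
      unfolding heat_solution_rescaled[OF \<open>t > 0\<close>]
      by (simp add: right_diff_distrib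
          Bochner_Integration.integral_diff[OF int[where B = B] int[where B = "2 * B"]] B step_bound)
    also have "\<bar>\<dots>\<bar> \<le> (LBINT z. \<bar>normal_density x (sqrt 2) z * (u0 (sqrt t * z) - step t z)\<bar>)"
      by (rule integral_abs_bound)
    also have "\<dots> \<le> (LBINT z. C * (normal_density 0 2 z * \<bar>u0 (sqrt t * z) - step t z\<bar>))"
    proof (rule integral_mono)
      show "integrable lborel (\<lambda>z. \<bar>normal_density x (sqrt 2) z * (u0 (sqrt t * z) - step t z)\<bar>)"
        by (intro integrable_abs int[where B = "3 * B"]) (auto simp: diff_bound)
      show "integrable lborel (\<lambda>z. C * (normal_density 0 2 z * \<bar>u0 (sqrt t * z) - step t z\<bar>))"
        by (intro integrable_mult_right int[where B = "3 * B"]) (auto simp: diff_bound)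
      show "\<bar>normal_density x (sqrt 2) z * (u0 (sqrt t * z) - step t z)\<bar>
          \<le> C * (normal_density 0 2 z * \<bar>u0 (sqrt t * z) - step t z\<bar>)" for z
        using mult_right_mono[OF normal_density_shift_le[of x L z],
            of "\<bar>u0 (sqrt t * z) - step t z\<bar>"] x
        by (simp add: abs_le_iff[of x] abs_mult C_def mult.assoc)
    qed
    also have "\<dots> = R t"
      by (simp add: R_def)
    finally show ?thesis .
  qed
  have R_lim: "(R \<longlongrightarrow> 0) (at_right 0)"
  \<comment> \<open>Dominated convergence is stated for sequences, so the limit is tested along
    sequences of positive times tending to 0.\<close>
  proof (rule tendsto_at_right_sequentially[of 0 1])
    fix S :: "nat \<Rightarrow> real"
    assume S: "\<And>n. 0 < S n" "S \<longlonglongrightarrow> 0"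
    have sqrt_S: "filterlim (\<lambda>n. sqrt (S n)) (at_right 0) sequentially"
      using tendsto_real_sqrt[OF S(2)] S(1) by (simp add: filterlim_at less_imp_neq[THEN not_sym])
    have "(\<lambda>n. LBINT z. normal_density 0 2 z * \<bar>u0 (sqrt (S n) * z) - step (S n) z\<bar>)
        \<longlonglongrightarrow> (LBINT z::real. 0)"
    proof (rule integral_dominated_convergence)
      show "integrable lborel (\<lambda>z. 3 * B * normal_density 0 2 z)"
        by simp
      have "(\<lambda>n. normal_density 0 2 z * \<bar>u0 (sqrt (S n) * z) - step (S n) z\<bar>) \<longlonglongrightarrow> 0"
        if "z \<noteq> 0" for z
      proof -
        \<comment> \<open>Off 0 exactly one indicator is active, which gives the form treated by
          \<open>tendsto_diff_rescaled_sgn\<close>, with \<open>sqrt (S n)\<close> as the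
          scale.\<close>
        have "step t z = u0 (sqrt t * sgn z)" for t
          using that by (auto simp: step_def sgn_if indicator_def)
        then show ?thesis
          using filterlim_compose[OF tendsto_diff_rescaled_sgn[OF u0' lim that] sqrt_S]
          by (auto intro!: tendsto_mult_right_zero tendsto_rabs_zero)
      qed
      then show "AE z in lborel.
          (\<lambda>n. normal_density 0 2 z * \<bar>u0 (sqrt (S n) * z) - step (S n) z\<bar>) \<longlonglongrightarrow> 0"
        using AE_lborel_singleton[of "0 :: real"] by auto
      show "AE z in lborel. norm (normal_density 0 2 z * \<bar>u0 (sqrt (S n) * z) - step (S n) z\<bar>)
          \<le> 3 * B * normal_density 0 2 z" for n
        using mult_right_mono[OF diff_bound normal_density_nonneg]
        by (auto simp: abs_mult mult.commute[of "normal_density 0 2 _"])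
    qed simp_all
    then show "(\<lambda>n. R (S n)) \<longlonglongrightarrow> 0"
      unfolding R_def by (auto intro!: tendsto_mult_right_zero)
  qed simp
  have pos: "\<forall>\<^sub>F t in at_right (0 :: real). 0 < t"
    by (simp add: eventually_at_right_less)
  show ?thesis
  proof (rule tendsto_sandwich[OF _ _ tendsto_const R_lim]; rule eventually_mono[OF pos])
    fix t :: real
    assume "0 < t"
    let ?f = "\<lambda>x. \<bar>heat_solution u0 (sqrt t * x) t - (F (- x) * u0 (- sqrt t) + F x * u0 (sqrt t))\<bar>"
    show "(SUP x\<in>{-L..L}. ?f x) \<le> R t"
      using \<open>L > 0\<close> bound[OF \<open>0 < t\<close>] by (intro cSUP_least) auto
    \<comment> \<open>A real \<open>SUP\<close> dominates the members of its family only when the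
      family is bounded above; the member at x = 0 then gives nonnegativity.\<close>
    have "bdd_above (?f ` {-L..L})"
      using bound[OF \<open>0 < t\<close>] by (rule bdd_aboveI2)
    then show "0 \<le> (SUP x\<in>{-L..L}. ?f x)"
      using \<open>L > 0\<close> by (intro cSUP_upper2[where x = 0]) auto
  qed
qed

end
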